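(* Let $(\mathcal G,\rho,\omega)$ be a symplectic Lie--Rinehart--Jacobi algebra over $A$ with extension $(\widehat{\mathcal G}_\omega,\widehat\rho)$, projection $\pi$ and canonical form $\eta$. The projection $\pi$ induces a central extension of Lie algebras $$0\longrightarrow H^0_\rho\,e\longrightarrow\mathrm{Cont}_{\mathrm{str}}(\widehat{\mathcal G}_\omega,\eta)\xrightarrow{\ \pi\ }\mathfrak{ham}\longrightarrow0,$$ and, equivalently, there is a central extension of Lie algebras $0\to H^0_\rho\to(A,\{\,,\})\to\mathfrak{ham}\to0$, where the map $A\to\mathfrak{ham}$ is $a\mapsto X_a$.
   Context: $K$ is a commutative field of characteristic zero and $A$ a commutative unital $K$-algebra; $L_a$ is multiplication by $a$. $\mathrm{Diff}^1_K(A)$ is the set of $K$-linear $D:A\to A$ with $[[D,L_a],L_b]=0$ for all $a,b\in A$. A Lie--Rinehart--Jacobi (LRJ) algebra over $A$ is an $A$-module $\mathcal G$ with a $K$-Lie algebra structure and an $A$-linear map (anchor) $\rho:\mathcal G\to\mathrm{Diff}^1_K(A)$ which is a Lie algebra morphism and satisfies $[x,ay]=a[x,y]+(\rho(x)(a)-a\rho(x)(1_A))y$. $C^p_\rho(\mathcal G,A)=\mathrm{Alt}^p_A(\mathcal G,A)$ is the module of alternating $A$-multilinear maps $\mathcal G^p\to A$, with differential $(d_\rho\beta)(x_0,\dots,x_p)=\sum_i(-1)^i\rho(x_i)\beta(x_0,\dots,\widehat{x_i},\dots,x_p)+\sum_{i<j}(-1)^{i+j}\beta([x_i,x_j],x_0,\dots,\widehat{x_i},\dots,\widehat{x_j},\dots,x_p)$;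 in particular $(d_\rho a)(x)=\rho(x)(a)$. $H^p_\rho$ denotes the cohomology; in particular $H^0_\rho=\{a\in A:\rho(x)(a)=0\ \forall x\in\mathcal G\}$. $i_x$ is the interior product and $\mathcal L^\rho_x=i_xd_\rho+d_\rho i_x$. The same notation is used for any LRJ algebra. A symplectic form on $(\mathcal G,\rho)$ is $\omega\in C^2_\rho(\mathcal G,A)$ with $d_\rho\omega=0$ and $\omega^\flat:\mathcal G\to\mathcal G^*=\mathrm{Hom}_A(\mathcal G,A)$, $x\mapsto i_x\omega$, an isomorphism of $A$-modules; $(\mathcal G,\rho,\omega)$ is then a symplectic LRJ algebra. The symplectic gradient $X_a\in\mathcal G$ of $a\in A$ is defined by $i_{X_a}\omega=d_\rho a$, and $\{a,b\}=-\omega(X_a,X_b)$, which is a $K$-Lie bracket on $A$. $\mathfrak{ham}=\{X_a:a\in A\}$ is the Lie algebra of Hamiltonian elements. The extension: $\widehat{\mathcal G}_\omega=\mathcal G\oplus Ae$ with $e$ generating a free summand of rank one, with bracket $[x+fe,y+ge]_\omega=[x,y]+(\rho(x)(g)-\rho(y)(f)+\omega(x,y))e$, anchor $\widehat\rho(x+fe)=\rho(x)$, projection $\pi(x+fe)=x$ and canonical form $\eta(x+fe)=f$. $(\widehat{\mathcal G}_\omega,\widehat\rho)$ is an LRJ algebra. $H^0_\rho\,e=\{ce:c\in H^0_\rho\}$. An element $u\in\widehat{\mathcal G}_\omega$ is a strict symmetry of $\eta$ if $\mathcal L^{\widehat\rho}_u\eta=0$; $\mathrm{Cont}_{\mathrm{str}}(\widehat{\mathcal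 G}_\omega,\eta)$ is the Lie subalgebra of strict symmetries. *)

theory Defs
  imports Complex_Main "HOL-Library.Product_Plus"
begin

text \<open>
  The underlying vector space of a Lie algebra is a subspace (the carrier) of a
  type-based vector space, so that Lie subalgebras are again Lie algebras.
\<close>

record ('k, 'v) lie_struct =
  lcarrier :: "'v set"
  lscale :: "'k \<Rightarrow> 'v \<Rightarrow> 'v"
  lbracket :: "'v \<Rightarrow> 'v \<Rightarrow> 'v"

definition lie_algebra :: "('k::field, 'v::ab_group_add) lie_struct \<Rightarrow> bool" where
  "lie_algebra L \<longleftrightarrow>
     vector_space (lscale L) \<and> module.subspace (lscale L) (lcarrier L) \<and>
     (\<forall>x\<in>lcarrier L. \<forall>y\<in>lcarrier L. lbracket L x y \<in> lcarrier L) \<and>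
     (\<forall>x\<in>lcarrier L. \<forall>y\<in>lcarrier L. \<forall>z\<in>lcarrier L.
        lbracket L (x + y) z = lbracket L x z + lbracket L y z \<and>
        lbracket L x (y + z) = lbracket L x y + lbracket L x z) \<and>
     (\<forall>k. \<forall>x\<in>lcarrier L. \<forall>y\<in>lcarrier L.
        lbracket L (lscale L k x) y = lscale L k (lbracket L x y) \<and>
        lbracket L x (lscale L k y) = lscale L k (lbracket L x y)) \<and>
     (\<forall>x\<in>lcarrier L. lbracket L x x = 0) \<and>
     (\<forall>x\<in>lcarrier L. \<forall>y\<in>lcarrier L. \<forall>z\<in>lcarrier L.
        lbracket L x (lbracket L y z) + lbracket L y (lbracket L z x)
          + lbracket L z (lbracket L x y) = 0)"

definition lie_hom ::
  "('k::field, 'v::ab_group_add) lie_struct \<Rightarrow> ('k, 'w::ab_group_add) lie_struct \<Rightarrow> ('v \<Rightarrow> 'w) \<Rightarrow> bool"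
where
  "lie_hom L M f \<longleftrightarrow>
     (\<forall>x\<in>lcarrier L. f x \<in> lcarrier M) \<and>
     (\<forall>x\<in>lcarrier L. \<forall>y\<in>lcarrier L. f (x + y) = f x + f y) \<and>
     (\<forall>k. \<forall>x\<in>lcarrier L. f (lscale L k x) = lscale M k (f x)) \<and>
     (\<forall>x\<in>lcarrier L. \<forall>y\<in>lcarrier L. f (lbracket L x y) = lbracket M (f x) (f y))"

definition lie_iso ::
  "('k::field, 'v::ab_group_add) lie_struct \<Rightarrow> ('k, 'w::ab_group_add) lie_struct \<Rightarrow> ('v \<Rightarrow> 'w) \<Rightarrow> bool"
where
  "lie_iso L M f \<longleftrightarrow> lie_hom L M f \<and> bij_betw f (lcarrier L) (lcarrier M)"

text \<open>\<open>0 \<longrightarrow> N \<longrightarrow> E \<longrightarrow> Q \<longrightarrow> 0\<close> with maps \<open>i\<close> and \<open>p\<close>: exact, with \<open>i(N)\<close> central in \<open>E\<close>.\<close>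

definition lie_central_extension ::
  "('k::field, 'u::ab_group_add) lie_struct \<Rightarrow> ('u \<Rightarrow> 'v) \<Rightarrow> ('k, 'v::ab_group_add) lie_struct
     \<Rightarrow> ('v \<Rightarrow> 'w) \<Rightarrow> ('k, 'w::ab_group_add) lie_struct \<Rightarrow> bool"
where
  "lie_central_extension N i E p Q \<longleftrightarrow>
     lie_algebra N \<and> lie_algebra E \<and> lie_algebra Q \<and>
     lie_hom N E i \<and> lie_hom E Q p \<and>
     inj_on i (lcarrier N) \<and>
     i ` lcarrier N = {x \<in> lcarrier E. p x = 0} \<and>
     p ` lcarrier E = lcarrier Q \<and>
     (\<forall>n\<in>lcarrier N. \<forall>x\<in>lcarrier E. lbracket E (i n) x = 0)"

definition comm_algebra :: "('k::field \<Rightarrow> 'a::comm_ring_1 \<Rightarrow> 'a) \<Rightarrow> bool" where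
  "comm_algebra sK \<longleftrightarrow> vector_space sK \<and> (\<forall>k a b. sK k (a * b) = sK k a * b)"

definition commutator :: "('a \<Rightarrow> 'a) \<Rightarrow> ('a \<Rightarrow> 'a) \<Rightarrow> 'a \<Rightarrow> 'a::ab_group_add" where
  "commutator D E = (\<lambda>x. D (E x) - E (D x))"

definition diff1 :: "('k::field \<Rightarrow> 'a::comm_ring_1 \<Rightarrow> 'a) \<Rightarrow> ('a \<Rightarrow> 'a) set" where
  "diff1 sK = {D. Vector_Spaces.linear sK sK D \<and>
                  (\<forall>a b. commutator (commutator D ((*) a)) ((*) b) = (\<lambda>_. 0))}"

text \<open>The \<open>K\<close>-vector space structure that an \<open>A\<close>-module inherits along \<open>K \<rightarrow> A\<close>, \<open>k \<mapsto> k\<cdot>1\<close>.\<close>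

definition restrict_scale ::
  "('k \<Rightarrow> 'a::comm_ring_1 \<Rightarrow> 'a) \<Rightarrow> ('a \<Rightarrow> 'g \<Rightarrow> 'g) \<Rightarrow> 'k \<Rightarrow> 'g \<Rightarrow> 'g"
where
  "restrict_scale sK sA k x = sA (sK k 1) x"

definition LRJ_lie ::
  "('k \<Rightarrow> 'a::comm_ring_1 \<Rightarrow> 'a) \<Rightarrow> ('a \<Rightarrow> 'g \<Rightarrow> 'g) \<Rightarrow> ('g \<Rightarrow> 'g \<Rightarrow> 'g) \<Rightarrow> ('k, 'g) lie_struct"
where
  "LRJ_lie sK sA br = \<lparr>lcarrier = UNIV, lscale = restrict_scale sK sA, lbracket = br\<rparr>"

definition LRJ_algebra ::
  "('k::field_char_0 \<Rightarrow> 'a::comm_ring_1 \<Rightarrow> 'a) \<Rightarrow> ('a \<Rightarrow> 'g::ab_group_add \<Rightarrow> 'g)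
     \<Rightarrow> ('g \<Rightarrow> 'g \<Rightarrow> 'g) \<Rightarrow> ('g \<Rightarrow> 'a \<Rightarrow> 'a) \<Rightarrow> bool"
where
  "LRJ_algebra sK sA br \<rho> \<longleftrightarrow>
     comm_algebra sK \<and> module sA \<and> lie_algebra (LRJ_lie sK sA br) \<and>
     (\<forall>x. \<rho> x \<in> diff1 sK) \<and>
     (\<forall>x y b. \<rho> (x + y) b = \<rho> x b + \<rho> y b) \<and>
     (\<forall>a x b. \<rho> (sA a x) b = a * \<rho> x b) \<and>
     (\<forall>x y. \<rho> (br x y) = commutator (\<rho> x) (\<rho> y)) \<and>
     (\<forall>x y a. br x (sA a y) = sA a (br x y) + sA (\<rho> x a - a * \<rho> x 1) y)"

text \<open>
  A \<open>p\<close>-cochain is a function on argument lists, extended by 0 to the lists whose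
  length is not \<open>p\<close>.
\<close>

definition cochains :: "('a::comm_ring_1 \<Rightarrow> 'g::ab_group_add \<Rightarrow> 'g) \<Rightarrow> nat \<Rightarrow> ('g list \<Rightarrow> 'a) set" where
  "cochains sA p = {\<beta>.
     (\<forall>xs. length xs \<noteq> p \<longrightarrow> \<beta> xs = 0) \<and>
     (\<forall>xs ys x y. length xs + 1 + length ys = p \<longrightarrow>
        \<beta> (xs @ (x + y) # ys) = \<beta> (xs @ x # ys) + \<beta> (xs @ y # ys)) \<and>
     (\<forall>xs ys a x. length xs + 1 + length ys = p \<longrightarrow>
        \<beta> (xs @ sA a x # ys) = a * \<beta> (xs @ x # ys)) \<and>
     (\<forall>xs. length xs = p \<and> \<not> distinct xs \<longrightarrow> \<beta> xs = 0)}"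

definition cochain0 :: "'a \<Rightarrow> 'g list \<Rightarrow> 'a::zero" where
  "cochain0 a xs = (if xs = [] then a else 0)"

text \<open>\<open>nths xs (- I)\<close> is \<open>xs\<close> with the entries at the positions in \<open>I\<close> omitted.\<close>

definition cdiff ::
  "('g \<Rightarrow> 'g \<Rightarrow> 'g) \<Rightarrow> ('g \<Rightarrow> 'a \<Rightarrow> 'a) \<Rightarrow> ('g list \<Rightarrow> 'a::comm_ring_1) \<Rightarrow> 'g list \<Rightarrow> 'a"
where
  "cdiff br \<rho> \<beta> xs =
     (\<Sum>i<length xs. (-1) ^ i * \<rho> (xs ! i) (\<beta> (nths xs (- {i})))) +
     (\<Sum>j<length xs. \<Sum>i<j. (-1) ^ (i + j) * \<beta> (br (xs ! i) (xs ! j) # nths xs (- {i, j})))"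

definition iprod :: "'g \<Rightarrow> ('g list \<Rightarrow> 'a) \<Rightarrow> 'g list \<Rightarrow> 'a" where
  "iprod x \<beta> = (\<lambda>xs. \<beta> (x # xs))"

definition lie_deriv ::
  "('g \<Rightarrow> 'g \<Rightarrow> 'g) \<Rightarrow> ('g \<Rightarrow> 'a \<Rightarrow> 'a) \<Rightarrow> 'g \<Rightarrow> ('g list \<Rightarrow> 'a::comm_ring_1) \<Rightarrow> 'g list \<Rightarrow> 'a"
where
  "lie_deriv br \<rho> x \<beta> = (\<lambda>xs. iprod x (cdiff br \<rho> \<beta>) xs + cdiff br \<rho> (iprod x \<beta>) xs)"

definition H0 :: "('g \<Rightarrow> 'a \<Rightarrow> 'a::zero) \<Rightarrow> 'a set" where
  "H0 \<rho> = {a. \<forall>x. \<rho> x a = 0}"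

definition flat :: "('g list \<Rightarrow> 'a) \<Rightarrow> 'g \<Rightarrow> 'g \<Rightarrow> 'a" where
  "flat \<omega> x = (\<lambda>y. iprod x \<omega> [y])"

text \<open>
  \<open>flat \<omega>\<close> is automatically \<open>A\<close>-linear for a 2-cochain \<open>\<omega>\<close>, so it is an isomorphism
  onto the dual module iff it is bijective onto it.
\<close>

definition symplectic_LRJ ::
  "('k::field_char_0 \<Rightarrow> 'a::comm_ring_1 \<Rightarrow> 'a) \<Rightarrow> ('a \<Rightarrow> 'g::ab_group_add \<Rightarrow> 'g)
     \<Rightarrow> ('g \<Rightarrow> 'g \<Rightarrow> 'g) \<Rightarrow> ('g \<Rightarrow> 'a \<Rightarrow> 'a) \<Rightarrow> ('g list \<Rightarrow> 'a) \<Rightarrow> bool"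
where
  "symplectic_LRJ sK sA br \<rho> \<omega> \<longleftrightarrow>
     LRJ_algebra sK sA br \<rho> \<and> \<omega> \<in> cochains sA 2 \<and> cdiff br \<rho> \<omega> = (\<lambda>_. 0) \<and>
     bij_betw (flat \<omega>) UNIV {\<phi>. module_hom sA (*) \<phi>}"

definition sgrad ::
  "('g \<Rightarrow> 'g \<Rightarrow> 'g) \<Rightarrow> ('g \<Rightarrow> 'a \<Rightarrow> 'a) \<Rightarrow> ('g list \<Rightarrow> 'a::comm_ring_1) \<Rightarrow> 'a \<Rightarrow> 'g"
where
  "sgrad br \<rho> \<omega> a = (THE x. iprod x \<omega> = cdiff br \<rho> (cochain0 a))"

definition poisson ::
  "('g \<Rightarrow> 'g \<Rightarrow> 'g) \<Rightarrow> ('g \<Rightarrow> 'a \<Rightarrow> 'a) \<Rightarrow> ('g list \<Rightarrow> 'a::comm_ring_1) \<Rightarrow> 'a \<Rightarrow> 'a \<Rightarrow> 'a"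
where
  "poisson br \<rho> \<omega> a b = - \<omega> [sgrad br \<rho> \<omega> a, sgrad br \<rho> \<omega> b]"

text \<open>\<open>x + fe\<close> is the pair \<open>(x, f)\<close>; the projection \<open>\<pi>\<close> is \<open>fst\<close>.\<close>

definition ext_scale :: "('a \<Rightarrow> 'g \<Rightarrow> 'g) \<Rightarrow> 'a::comm_ring_1 \<Rightarrow> 'g \<times> 'a \<Rightarrow> 'g \<times> 'a" where
  "ext_scale sA a u = (sA a (fst u), a * snd u)"

definition ext_bracket ::
  "('g \<Rightarrow> 'g \<Rightarrow> 'g) \<Rightarrow> ('g \<Rightarrow> 'a \<Rightarrow> 'a) \<Rightarrow> ('g list \<Rightarrow> 'a::comm_ring_1)
     \<Rightarrow> 'g \<times> 'a \<Rightarrow> 'g \<times> 'a \<Rightarrow> 'g \<times> 'a"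
where
  "ext_bracket br \<rho> \<omega> u v =
     (br (fst u) (fst v), \<rho> (fst u) (snd v) - \<rho> (fst v) (snd u) + \<omega> [fst u, fst v])"

definition ext_anchor :: "('g \<Rightarrow> 'a \<Rightarrow> 'a) \<Rightarrow> 'g \<times> 'a \<Rightarrow> 'a \<Rightarrow> 'a" where
  "ext_anchor \<rho> u = \<rho> (fst u)"

definition ext_e :: "'g::zero \<times> 'a::comm_ring_1" where
  "ext_e = (0, 1)"

definition ext_eta :: "('g \<times> 'a) list \<Rightarrow> 'a::zero" where
  "ext_eta us = (case us of [u] \<Rightarrow> snd u | _ \<Rightarrow> 0)"

definition cont_str ::
  "('g \<Rightarrow> 'g \<Rightarrow> 'g) \<Rightarrow> ('g \<Rightarrow> 'a \<Rightarrow> 'a) \<Rightarrow> ('g list \<Rightarrow> 'a::comm_ring_1) \<Rightarrow> ('g \<times> 'a) set"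
where
  "cont_str br \<rho> \<omega> =
     {u. lie_deriv (ext_bracket br \<rho> \<omega>) (ext_anchor \<rho>) u ext_eta = (\<lambda>_. 0)}"

definition ham_lie ::
  "('k \<Rightarrow> 'a::comm_ring_1 \<Rightarrow> 'a) \<Rightarrow> ('a \<Rightarrow> 'g \<Rightarrow> 'g) \<Rightarrow> ('g \<Rightarrow> 'g \<Rightarrow> 'g)
     \<Rightarrow> ('g \<Rightarrow> 'a \<Rightarrow> 'a) \<Rightarrow> ('g list \<Rightarrow> 'a) \<Rightarrow> ('k, 'g) lie_struct"
where
  "ham_lie sK sA br \<rho> \<omega> = (LRJ_lie sK sA br)\<lparr>lcarrier := range (sgrad br \<rho> \<omega>)\<rparr>"

definition ext_lie ::
  "('k \<Rightarrow> 'a::comm_ring_1 \<Rightarrow> 'a) \<Rightarrow> ('a \<Rightarrow> 'g \<Rightarrow> 'g) \<Rightarrow> ('g \<Rightarrow> 'g \<Rightarrow> 'g)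
     \<Rightarrow> ('g \<Rightarrow> 'a \<Rightarrow> 'a) \<Rightarrow> ('g list \<Rightarrow> 'a) \<Rightarrow> ('k, 'g \<times> 'a) lie_struct"
where
  "ext_lie sK sA br \<rho> \<omega> = LRJ_lie sK (ext_scale sA) (ext_bracket br \<rho> \<omega>)"

definition cont_str_lie ::
  "('k \<Rightarrow> 'a::comm_ring_1 \<Rightarrow> 'a) \<Rightarrow> ('a \<Rightarrow> 'g \<Rightarrow> 'g) \<Rightarrow> ('g \<Rightarrow> 'g \<Rightarrow> 'g)
     \<Rightarrow> ('g \<Rightarrow> 'a \<Rightarrow> 'a) \<Rightarrow> ('g list \<Rightarrow> 'a) \<Rightarrow> ('k, 'g \<times> 'a) lie_struct"
where
  "cont_str_lie sK sA br \<rho> \<omega> = (ext_lie sK sA br \<rho> \<omega>)\<lparr>lcarrier := cont_str br \<rho> \<omega>\<rparr>"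

definition H0e_lie ::
  "('k \<Rightarrow> 'a::comm_ring_1 \<Rightarrow> 'a) \<Rightarrow> ('a \<Rightarrow> 'g::zero \<Rightarrow> 'g) \<Rightarrow> ('g \<Rightarrow> 'g \<Rightarrow> 'g)
     \<Rightarrow> ('g \<Rightarrow> 'a \<Rightarrow> 'a) \<Rightarrow> ('g list \<Rightarrow> 'a) \<Rightarrow> ('k, 'g \<times> 'a) lie_struct"
where
  "H0e_lie sK sA br \<rho> \<omega> =
     (ext_lie sK sA br \<rho> \<omega>)\<lparr>lcarrier := (\<lambda>c. ext_scale sA c ext_e) ` H0 \<rho>\<rparr>"

definition poisson_lie ::
  "('k \<Rightarrow> 'a::comm_ring_1 \<Rightarrow> 'a) \<Rightarrow> ('g \<Rightarrow> 'g \<Rightarrow> 'g)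
     \<Rightarrow> ('g \<Rightarrow> 'a \<Rightarrow> 'a) \<Rightarrow> ('g list \<Rightarrow> 'a) \<Rightarrow> ('k, 'a) lie_struct"
where
  "poisson_lie sK br \<rho> \<omega> = \<lparr>lcarrier = UNIV, lscale = sK, lbracket = poisson br \<rho> \<omega>\<rparr>"

definition H0_lie ::
  "('k \<Rightarrow> 'a::comm_ring_1 \<Rightarrow> 'a) \<Rightarrow> ('g \<Rightarrow> 'g \<Rightarrow> 'g)
     \<Rightarrow> ('g \<Rightarrow> 'a \<Rightarrow> 'a) \<Rightarrow> ('g list \<Rightarrow> 'a) \<Rightarrow> ('k, 'a) lie_struct"
where
  "H0_lie sK br \<rho> \<omega> = (poisson_lie sK br \<rho> \<omega>)\<lparr>lcarrier := H0 \<rho>\<rparr>"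

end

theory Submission
  imports Defs
begin

text \<open>
  Write \<open>X\<^sub>a\<close> for the symplectic gradient of \<open>a\<close> and \<open>{a, b}\<close> for the Poisson bracket.
  By antisymmetry of \<open>\<omega>\<close>, the bracket is \<open>{a, b} = \<rho>(X\<^sub>a)(b)\<close>. Evaluating \<open>d\<omega> = 0\<close> on
  \<open>(X\<^sub>a, X\<^sub>b, z)\<close> gives \<open>X\<^bsub>{a,b}\<^esub> = [X\<^sub>a, X\<^sub>b]\<close> (lemma \<open>sgrad_poisson\<close>). These two
  identities, together with the fact that \<open>\<rho>\<close> preserves brackets, make \<open>A\<close> a Lie algebra and
  \<open>a \<mapsto> X\<^sub>a\<close> a Lie morphism onto the Hamiltonian elements. By nondegeneracy its kernel is
  \<open>{a. da = 0}\<close>, which is \<open>H\<^sup>0\<close>. It is central, because \<open>{c, b} = \<rho>(X\<^sub>c)(b)\<close> vanishes as soon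
  as \<open>X\<^sub>c = 0\<close>. This is the second of the two extensions (lemma \<open>poisson_central_extension\<close>).

  The first extension is the second one seen through an isomorphism. A direct computation gives
  \<open>(L\<^sub>u\<eta>)(y + ge) = \<rho>(y)(f) - \<omega>(x, y)\<close> for \<open>u = x + fe\<close>, so \<open>u\<close> is a strict symmetry exactly
  when \<open>x = X\<^sub>f\<close> (lemma \<open>cont_str_eq\<close>). In other words, the strict symmetries are the graph of
  \<open>X\<close>. The bracket of the extension restricts on this graph to the Poisson bracket, so
  \<open>a \<mapsto> X\<^sub>a + ae\<close> is a Lie isomorphism from \<open>A\<close> onto the strict symmetries. It maps \<open>H\<^sup>0\<close> to
  \<open>H\<^sup>0 e\<close> and turns the map \<open>X\<close> into the projection.
\<close>

section \<open>Lie algebras and central extensions\<close>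

lemma lie_algebraD:
  assumes "lie_algebra L"
  shows "vector_space (lscale L)" "module.subspace (lscale L) (lcarrier L)"
    "\<And>x y. x \<in> lcarrier L \<Longrightarrow> y \<in> lcarrier L \<Longrightarrow> lbracket L x y \<in> lcarrier L"
    "\<And>x y. x \<in> lcarrier L \<Longrightarrow> y \<in> lcarrier L \<Longrightarrow> x + y \<in> lcarrier L"
    "\<And>k x. x \<in> lcarrier L \<Longrightarrow> lscale L k x \<in> lcarrier L"
    "0 \<in> lcarrier L"
proof -
  show vs: "vector_space (lscale L)" and sub: "module.subspace (lscale L) (lcarrier L)"
    and "\<And>x y. x \<in> lcarrier L \<Longrightarrow> y \<in> lcarrier L \<Longrightarrow> lbracket L x y \<in> lcarrier L"
    using assms unfolding lie_algebra_def by blast+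
  interpret vector_space "lscale L" by (rule vs)
  show "\<And>x y. x \<in> lcarrier L \<Longrightarrow> y \<in> lcarrier L \<Longrightarrow> x + y \<in> lcarrier L"
    "\<And>k x. x \<in> lcarrier L \<Longrightarrow> lscale L k x \<in> lcarrier L" "0 \<in> lcarrier L"
    using sub by (auto simp: subspace_add subspace_scale subspace_0)
qed

lemma lie_homD:
  assumes "lie_hom L M f"
  shows "\<And>x. x \<in> lcarrier L \<Longrightarrow> f x \<in> lcarrier M"
    "\<And>x y. x \<in> lcarrier L \<Longrightarrow> y \<in> lcarrier L \<Longrightarrow> f (x + y) = f x + f y"
    "\<And>k x. x \<in> lcarrier L \<Longrightarrow> f (lscale L k x) = lscale M k (f x)"
    "\<And>x y. x \<in> lcarrier L \<Longrightarrow> y \<in> lcarrier L \<Longrightarrow> f (lbracket L x y) = lbracket M (f x) (f y)"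
  using assms unfolding lie_hom_def by blast+

lemma lie_hom_zero:
  assumes "lie_algebra L" "lie_hom L M f"
  shows "f 0 = 0"
  using lie_homD(2)[OF assms(2), of 0 0] lie_algebraD(6)[OF assms(1)] by simp

text \<open>
  The Lie algebra axioms are closure conditions and equations, so they pass along a surjective
  morphism. In this way the Hamiltonian elements and the strict symmetries become Lie algebras
  as images of \<open>A\<close>, and \<open>H\<^sup>0 e\<close> as an image of \<open>H\<^sup>0\<close>.
\<close>

lemma lie_algebra_image:
  assumes L: "lie_algebra L" and vs: "vector_space (lscale M)" and f: "lie_hom L M f"
    and onto: "f ` lcarrier L = lcarrier M"
  shows "lie_algebra M"
proof -
  interpret M: vector_space "lscale M" by (rule vs)
  note f' = lie_homD(2-4)[OF f, symmetric]
  note cl = lie_algebraD(3-6)[OF L]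
  note f0 = lie_hom_zero[OF L f]
  have sub: "M.subspace (lcarrier M)"
    unfolding M.subspace_def onto[symmetric]
    using cl f0 by (auto simp: f' intro!: imageI)
  have add: "lbracket L (x + y) z = lbracket L x z + lbracket L y z"
    "lbracket L x (y + z) = lbracket L x y + lbracket L x z"
    if "x \<in> lcarrier L" "y \<in> lcarrier L" "z \<in> lcarrier L" for x y z
    using L that unfolding lie_algebra_def by blast+
  have scale: "lbracket L (lscale L k x) y = lscale L k (lbracket L x y)"
    "lbracket L x (lscale L k y) = lscale L k (lbracket L x y)"
    if "x \<in> lcarrier L" "y \<in> lcarrier L" for k x y
    using L that unfolding lie_algebra_def by blast+
  have alt: "lbracket L x x = 0" if "x \<in> lcarrier L" for x
    using L that unfolding lie_algebra_def by blast
  have jac: "lbracket L x (lbracket L y z) + lbracket L y (lbracket L z x)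
          + lbracket L z (lbracket L x y) = 0"
    if "x \<in> lcarrier L" "y \<in> lcarrier L" "z \<in> lcarrier L" for x y z
    using L that unfolding lie_algebra_def by blast
  show ?thesis
    unfolding lie_algebra_def onto[symmetric]
    using vs sub[folded onto]
    by (simp add: f' add scale alt jac f0 cl)
qed

lemma lie_algebra_subalgebra:
  assumes L: "lie_algebra L" and sub: "module.subspace (lscale L) S"
    and "S \<subseteq> lcarrier L" "\<And>x y. x \<in> S \<Longrightarrow> y \<in> S \<Longrightarrow> lbracket L x y \<in> S"
  shows "lie_algebra (L\<lparr>lcarrier := S\<rparr>)"
  using assms unfolding lie_algebra_def by (auto simp: subset_iff)

text \<open>
  Scalar multiplication is an operation on the whole type, while \<open>\<Psi>\<close> and \<open>\<Phi>\<close> only control it on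
  the carriers. Therefore the vector space axioms of the new structures are hypotheses;
  everything else is carried over by the isomorphisms.
\<close>

lemma lie_central_extension_transport:
  assumes ext: "lie_central_extension N i E p Q"
    and \<Psi>: "lie_iso N N' \<Psi>" and \<Phi>: "lie_iso E E' \<Phi>"
    and vs: "vector_space (lscale N')" "vector_space (lscale E')"
    and i': "\<And>n. n \<in> lcarrier N \<Longrightarrow> i' (\<Psi> n) = \<Phi> (i n)"
    and p': "\<And>x. x \<in> lcarrier E \<Longrightarrow> p' (\<Phi> x) = p x"
  shows "lie_central_extension N' i' E' p' Q"
proof -
  have alg: "lie_algebra N" "lie_algebra E" "lie_algebra Q"
    and i: "lie_hom N E i" and p: "lie_hom E Q p" and inj_i: "inj_on i (lcarrier N)"
    and ker: "i ` lcarrier N = {x \<in> lcarrier E. p x = 0}"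
    and onto: "p ` lcarrier E = lcarrier Q"
    and central: "\<And>n x. n \<in> lcarrier N \<Longrightarrow> x \<in> lcarrier E \<Longrightarrow> lbracket E (i n) x = 0"
    using ext unfolding lie_central_extension_def by blast+
  have \<Psi>h: "lie_hom N N' \<Psi>" and \<Phi>h: "lie_hom E E' \<Phi>"
    and N': "lcarrier N' = \<Psi> ` lcarrier N" and E': "lcarrier E' = \<Phi> ` lcarrier E"
    and \<Phi>inj: "inj_on \<Phi> (lcarrier E)"
    using \<Psi> \<Phi> unfolding lie_iso_def bij_betw_def by auto
  note cl = lie_algebraD(3-5)[OF alg(1)] lie_algebraD(3-5)[OF alg(2)]
  note \<Psi>' = lie_homD(2-4)[OF \<Psi>h, symmetric]
  note \<Phi>' = lie_homD(2-4)[OF \<Phi>h, symmetric]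
  have alg': "lie_algebra N'" "lie_algebra E'"
    using lie_algebra_image[OF alg(1) vs(1) \<Psi>h] lie_algebra_image[OF alg(2) vs(2) \<Phi>h] N' E'
    by auto
  have "lie_hom N' E' i'"
    unfolding lie_hom_def N' E'
    by (auto simp: \<Psi>' \<Phi>' i' cl lie_homD[OF i])
  moreover have "lie_hom E' Q p'"
    unfolding lie_hom_def E'
    by (auto simp: \<Phi>' p' cl lie_homD[OF p])
  moreover have "inj_on i' (lcarrier N')"
  proof (rule inj_onI, unfold N', safe)
    fix m n assume mn: "m \<in> lcarrier N" "n \<in> lcarrier N" and "i' (\<Psi> m) = i' (\<Psi> n)"
    then have "i m = i n" using inj_onD[OF \<Phi>inj] lie_homD(1)[OF i] by (simp add: i')
    then show "\<Psi> m = \<Psi> n" using inj_onD[OF inj_i] mn by blast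
  qed
  moreover have "i' ` lcarrier N' = {x \<in> lcarrier E'. p' x = 0}"
  proof -
    have "i' ` lcarrier N' = \<Phi> ` (i ` lcarrier N)"
      unfolding N' image_image by (rule image_cong) (simp_all add: i')
    also have "\<dots> = {x \<in> lcarrier E'. p' x = 0}"
      unfolding ker E' by (auto simp: p')
    finally show ?thesis .
  qed
  moreover have "p' ` lcarrier E' = lcarrier Q"
    unfolding E' onto[symmetric] image_image by (rule image_cong) (simp_all add: p')
  moreover have "lbracket E' (i' n) x = 0" if "n \<in> lcarrier N'" "x \<in> lcarrier E'" for n x
    using that unfolding N' E'
    by (auto simp: i' \<Phi>' lie_homD(1)[OF i] central lie_hom_zero[OF alg(2) \<Phi>h])
  ultimately show ?thesis
    using alg alg' unfolding lie_central_extension_def by blast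
qed

section \<open>The low-degree part of the Chevalley--Eilenberg complex\<close>

lemma cdiff_0: "cdiff br \<rho> \<beta> [] = 0"
  by (simp add: cdiff_def)

lemma cdiff_1: "cdiff br \<rho> \<beta> [x] = \<rho> x (\<beta> [])"
  by (simp add: cdiff_def nths_Cons)

lemma cdiff_2: "cdiff br \<rho> \<beta> [x, y] = \<rho> x (\<beta> [y]) - \<rho> y (\<beta> [x]) - \<beta> [br x y]"
  by (simp add: cdiff_def nths_Cons lessThan_Suc)

lemma cdiff_3:
  "cdiff br \<rho> \<beta> [x, y, z] =
     \<rho> x (\<beta> [y, z]) - \<rho> y (\<beta> [x, z]) + \<rho> z (\<beta> [x, y])
     - \<beta> [br x y, z] + \<beta> [br x z, y] - \<beta> [br y z, x]"
  by (simp add: cdiff_def nths_Cons lessThan_Suc numeral_3_eq_3)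

lemma length_le_nths_Compl:
  assumes "finite I"
  shows "length xs \<le> length (nths xs (- I)) + card I"
proof -
  have "{k. k < length xs \<and> k \<in> - I} = {..<length xs} - I" by auto
  then have "length (nths xs (- I)) = card ({..<length xs} - I)" by (simp only: length_nths)
  then show ?thesis using diff_card_le_card_Diff[OF assms, of "{..<length xs}"] by simp
qed

text \<open>
  Forms are extended by 0 to argument lists of the wrong length, and equations between forms
  range over lists of every length. This lemma disposes of the long lists: every summand of the
  differential evaluates \<open>\<beta>\<close> on a list that is shorter by one.
\<close>

lemma cdiff_zero_beyond:
  assumes "\<And>x. \<rho> x 0 = 0" and \<beta>: "\<And>ys. length xs \<le> Suc (length ys) \<Longrightarrow> \<beta> ys = 0"
  shows "cdiff br \<rho> \<beta> xs = 0"
proof -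
  have "\<beta> (nths xs (- {i})) = 0" for i
    using length_le_nths_Compl[of "{i}" xs] by (intro \<beta>) simp
  moreover have "\<beta> (z # nths xs (- {i, j})) = 0" for z i j
  proof (rule \<beta>)
    have "card {i, j} \<le> 2" by (simp add: card_insert_if)
    then show "length xs \<le> Suc (length (z # nths xs (- {i, j})))"
      using length_le_nths_Compl[of "{i, j}" xs] by simp
  qed
  ultimately show ?thesis by (simp add: cdiff_def assms(1))
qed

section \<open>Symplectic gradients and the Poisson bracket\<close>

locale symplectic_lrj =
  fixes sK :: "'k::field_char_0 \<Rightarrow> 'a::comm_ring_1 \<Rightarrow> 'a"
    and sA :: "'a \<Rightarrow> 'g::ab_group_add \<Rightarrow> 'g"
    and br :: "'g \<Rightarrow> 'g \<Rightarrow> 'g"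
    and \<rho> :: "'g \<Rightarrow> 'a \<Rightarrow> 'a"
    and \<omega> :: "'g list \<Rightarrow> 'a"
  assumes symplectic: "symplectic_LRJ sK sA br \<rho> \<omega>"
begin

abbreviation "X \<equiv> sgrad br \<rho> \<omega>"
abbreviation "P \<equiv> poisson br \<rho> \<omega>"

lemma LRJ: "LRJ_algebra sK sA br \<rho>"
  using symplectic by (simp add: symplectic_LRJ_def)

sublocale K: vector_space sK
  using LRJ by (simp add: LRJ_algebra_def comm_algebra_def)

sublocale A: module sA
  using LRJ by (simp add: LRJ_algebra_def)

lemma sK_eq_mult: "sK k a = sK k 1 * a"
  using LRJ unfolding LRJ_algebra_def comm_algebra_def by (metis mult_1)

lemma lie_G: "lie_algebra (LRJ_lie sK sA br)"
  using LRJ by (simp add: LRJ_algebra_def)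

lemma anchor_add_left: "\<rho> (x + y) b = \<rho> x b + \<rho> y b"
  and anchor_mult_left: "\<rho> (sA a x) b = a * \<rho> x b"
  and anchor_bracket: "\<rho> (br x y) b = \<rho> x (\<rho> y b) - \<rho> y (\<rho> x b)"
  using LRJ unfolding LRJ_algebra_def commutator_def by auto

lemma anchor_linear: "Vector_Spaces.linear sK sK (\<rho> x)"
  using LRJ by (simp add: LRJ_algebra_def diff1_def)

lemma anchor_add: "\<rho> x (a + b) = \<rho> x a + \<rho> x b"
  and anchor_scale: "\<rho> x (sK k a) = sK k (\<rho> x a)"
  and anchor_zero [simp]: "\<rho> x 0 = 0"
  and anchor_minus: "\<rho> x (- a) = - \<rho> x a"
proof -
  interpret r: Vector_Spaces.linear sK sK "\<rho> x" by (rule anchor_linear)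
  show "\<rho> x (a + b) = \<rho> x a + \<rho> x b" "\<rho> x (sK k a) = sK k (\<rho> x a)"
    "\<rho> x 0 = 0" "\<rho> x (- a) = - \<rho> x a"
    by (rule r.add r.scale r.zero r.neg)+
qed

lemma anchor_zero_left [simp]: "\<rho> 0 b = 0"
  using anchor_add_left[of 0 0 b] by simp

lemma omega_cochain: "\<omega> \<in> cochains sA 2"
  using symplectic by (simp add: symplectic_LRJ_def)

lemma omega_length: "length xs \<noteq> 2 \<Longrightarrow> \<omega> xs = 0"
  using omega_cochain by (simp add: cochains_def)

lemma omega_add_left: "\<omega> [x + y, z] = \<omega> [x, z] + \<omega> [y, z]"
  and omega_add_right: "\<omega> [x, y + z] = \<omega> [x, y] + \<omega> [x, z]"
  and omega_scale_left: "\<omega> [sA a x, z] = a * \<omega> [x, z]"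
  and omega_alt [simp]: "\<omega> [x, x] = 0"
proof -
  have add: "\<omega> (xs @ (u + v) # ys) = \<omega> (xs @ u # ys) + \<omega> (xs @ v # ys)"
    if "length xs + 1 + length ys = 2" for xs ys u v
    using omega_cochain that unfolding cochains_def by blast
  have scale: "\<omega> (xs @ sA a u # ys) = a * \<omega> (xs @ u # ys)"
    if "length xs + 1 + length ys = 2" for xs ys u
    using omega_cochain that unfolding cochains_def by blast
  show "\<omega> [x + y, z] = \<omega> [x, z] + \<omega> [y, z]" "\<omega> [x, y + z] = \<omega> [x, y] + \<omega> [x, z]"
    "\<omega> [sA a x, z] = a * \<omega> [x, z]"
    using add[of "[]" "[z]" x y] add[of "[x]" "[]" y z] scale[of "[]" "[z]" x] by simp_all
  have "\<forall>xs. length xs = 2 \<and> \<not> distinct xs \<longrightarrow> \<omega> xs = 0"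
    using omega_cochain unfolding cochains_def by blast
  then show "\<omega> [x, x] = 0" by simp
qed

lemma omega_antisym: "\<omega> [x, y] = - \<omega> [y, x]"
  using omega_alt[of "x + y"]
  by (simp add: omega_add_left omega_add_right eq_neg_iff_add_eq_0 del: omega_alt)
     (simp add: add.commute)

lemma omega_nondegenerate:
  assumes "\<And>z. \<omega> [x, z] = \<omega> [y, z]"
  shows "x = y"
proof -
  have "inj (flat \<omega>)"
    using symplectic by (auto simp: symplectic_LRJ_def bij_betw_def)
  moreover have "flat \<omega> x = flat \<omega> y" using assms by (simp add: flat_def iprod_def)
  ultimately show ?thesis by (rule injD)
qed

lemma omega_closed:
  "\<rho> x (\<omega> [y, z]) - \<rho> y (\<omega> [x, z]) + \<rho> z (\<omega> [x, y])
     - \<omega> [br x y, z] + \<omega> [br x z, y] - \<omega> [br y z, x] = 0"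
proof -
  have "cdiff br \<rho> \<omega> [x, y, z] = 0" using symplectic by (simp add: symplectic_LRJ_def)
  then show ?thesis by (simp add: cdiff_3)
qed

text \<open>
  Reduces the defining equation of the symplectic gradient, an equation of functions on lists
  of arbitrary length, to its only nontrivial case, that of one argument.
\<close>

lemma iprod_omega_eq_d_iff:
  "iprod x \<omega> = cdiff br \<rho> (cochain0 a) \<longleftrightarrow> (\<forall>z. \<omega> [x, z] = \<rho> z a)"
proof
  assume eq: "iprod x \<omega> = cdiff br \<rho> (cochain0 a)"
  show "\<forall>z. \<omega> [x, z] = \<rho> z a"
  proof
    fix z show "\<omega> [x, z] = \<rho> z a"
      using fun_cong[OF eq, of "[z]"] by (simp add: iprod_def cdiff_1 cochain0_def)
  qed
next
  assume *: "\<forall>z. \<omega> [x, z] = \<rho> z a"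
  show "iprod x \<omega> = cdiff br \<rho> (cochain0 a)"
  proof
    fix zs :: "'g list"
    consider "zs = []" | z where "zs = [z]" | "length zs \<ge> 2"
      by (cases zs rule: remdups_adj.cases) auto
    then show "iprod x \<omega> zs = cdiff br \<rho> (cochain0 a) zs"
    proof cases
      case 3
      then have "cdiff br \<rho> (cochain0 a) zs = 0"
        by (intro cdiff_zero_beyond) (auto simp: cochain0_def)
      with 3 show ?thesis by (simp add: iprod_def omega_length)
    qed (auto simp: * iprod_def omega_length cdiff_0 cdiff_1 cochain0_def)
  qed
qed

lemma sgrad_eqI:
  assumes "\<And>z. \<omega> [x, z] = \<rho> z a"
  shows "X a = x"
  unfolding sgrad_def iprod_omega_eq_d_iff
  by (rule the_equality) (auto simp: assms intro: omega_nondegenerate)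

text \<open>
  Existence of the gradient: \<open>z \<mapsto> \<rho>(z)(a)\<close> is \<open>A\<close>-linear because the anchor is, so it lies in
  the image of \<open>\<omega>\<^sup>\<flat>\<close>.
\<close>

lemma omega_sgrad: "\<omega> [X a, z] = \<rho> z a"
proof -
  have "module_hom sA (*) (\<lambda>z. \<rho> z a)"
    by (auto simp: module_hom_iff anchor_add_left anchor_mult_left A.module_axioms
        intro!: module.intro simp: algebra_simps)
  then have "(\<lambda>z. \<rho> z a) \<in> range (flat \<omega>)"
    using symplectic by (simp add: symplectic_LRJ_def bij_betw_def)
  then obtain x where "\<And>z. \<rho> z a = \<omega> [x, z]"
    by (auto simp: flat_def iprod_def fun_eq_iff)
  then show ?thesis using sgrad_eqI[of x a] by simp
qed

lemma sgrad_eq_iff: "X a = x \<longleftrightarrow> (\<forall>z. \<omega> [x, z] = \<rho> z a)"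
  using sgrad_eqI omega_sgrad by blast

lemma sgrad_add: "X (a + b) = X a + X b"
  by (rule sgrad_eqI) (simp add: omega_add_left omega_sgrad anchor_add)

lemma sgrad_scale: "X (sK k a) = restrict_scale sK sA k (X a)"
  by (rule sgrad_eqI)
     (simp add: restrict_scale_def omega_scale_left omega_sgrad anchor_scale sK_eq_mult[symmetric])

lemma sgrad_eq_0_iff: "X a = 0 \<longleftrightarrow> a \<in> H0 \<rho>"
proof -
  have "\<omega> [0, z] = 0" for z using omega_add_left[of 0 0 z] by simp
  then show ?thesis by (auto simp: sgrad_eq_iff H0_def)
qed

lemma poisson_eq_anchor: "P a b = \<rho> (X a) b"
  using omega_antisym[of "X a" "X b"] by (simp add: poisson_def omega_sgrad)

lemma poisson_antisym: "P a b = - P b a"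
  using omega_antisym[of "X a" "X b"] by (simp add: poisson_def)

text \<open>
  The central identity. In \<open>d\<omega>(X\<^sub>a, X\<^sub>b, z) = 0\<close> the terms \<open>\<rho>(X\<^sub>a)\<rho>(z)(b)\<close> and
  \<open>\<rho>(X\<^sub>b)\<rho>(z)(a)\<close> cancel against parts of \<open>\<omega>([X\<^sub>a, z], X\<^sub>b)\<close> and \<open>\<omega>([X\<^sub>b, z], X\<^sub>a)\<close>. Of the
  three remaining copies of \<open>\<rho>(z)(\<omega>(X\<^sub>a, X\<^sub>b))\<close> two have the negative sign, which leaves
  \<open>\<omega>([X\<^sub>a, X\<^sub>b], z) = - \<rho>(z)(\<omega>(X\<^sub>a, X\<^sub>b))\<close>.
\<close>

lemma sgrad_poisson: "X (P a b) = br (X a) (X b)"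
proof (rule sgrad_eqI)
  fix z
  let ?x = "X a" and ?y = "X b" and ?w = "\<omega> [X a, X b]"
  have r: "\<rho> ?x b = - ?w" "\<rho> ?y a = ?w"
    using omega_antisym[of ?x ?y] by (simp_all add: omega_sgrad)
  have xz: "\<omega> [br ?x z, ?y] = - \<rho> ?x (\<rho> z b) - \<rho> z ?w"
    using omega_antisym[of "br ?x z" ?y] r
    by (simp add: omega_sgrad[of b "br ?x z"] anchor_bracket anchor_minus)
  have yz: "\<omega> [br ?y z, ?x] = \<rho> z ?w - \<rho> ?y (\<rho> z a)"
    using omega_antisym[of "br ?y z" ?x] r by (simp add: omega_sgrad[of a "br ?y z"] anchor_bracket)
  have "- \<omega> [br ?x ?y, z] - \<rho> z ?w =
      \<rho> ?x (\<omega> [?y, z]) - \<rho> ?y (\<omega> [?x, z]) + \<rho> z ?w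
        - \<omega> [br ?x ?y, z] + \<omega> [br ?x z, ?y] - \<omega> [br ?y z, ?x]"
    unfolding xz yz omega_sgrad[of a z] omega_sgrad[of b z] by simp
  also have "\<dots> = 0" by (rule omega_closed)
  finally have "\<omega> [br ?x ?y, z] = - \<rho> z ?w"
    by (metis eq_iff_diff_eq_0 minus_equation_iff)
  then show "\<omega> [br ?x ?y, z] = \<rho> z (P a b)"
    by (simp add: poisson_def anchor_minus)
qed

text \<open>
  With \<open>{a, b} = \<rho>(X\<^sub>a)(b)\<close>, the Jacobi identity says that \<open>\<rho>\<close> maps \<open>[X\<^sub>a, X\<^sub>b]\<close> to the commutator
  of \<open>\<rho>(X\<^sub>a)\<close> and \<open>\<rho>(X\<^sub>b)\<close>.
\<close>

lemma poisson_jacobi: "P a (P b c) + P b (P c a) + P c (P a b) = 0"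
proof -
  have "P b (P c a) = - P b (P a c)"
    using poisson_antisym[of c a] by (simp add: poisson_eq_anchor anchor_minus)
  moreover have "P c (P a b) = - P (P a b) c" by (rule poisson_antisym)
  ultimately show ?thesis
    by (simp add: poisson_eq_anchor sgrad_poisson[unfolded poisson_eq_anchor] anchor_bracket)
qed

lemma lie_algebra_poisson: "lie_algebra (poisson_lie sK br \<rho> \<omega>)"
proof -
  have "P (a + b) c = P a c + P b c" "P a (b + c) = P a b + P a c" for a b c
    by (simp_all add: poisson_eq_anchor sgrad_add anchor_add_left anchor_add)
  moreover have "P (sK k a) b = sK k (P a b)" "P a (sK k b) = sK k (P a b)" for k a b
    by (simp_all add: poisson_eq_anchor sgrad_scale restrict_scale_def anchor_mult_left
        anchor_scale sK_eq_mult[symmetric])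
  moreover have "P a a = 0" for a by (simp add: poisson_def)
  ultimately show ?thesis
    using poisson_jacobi
    by (simp add: lie_algebra_def poisson_lie_def K.vector_space_axioms)
qed

lemma lie_hom_sgrad: "lie_hom (poisson_lie sK br \<rho> \<omega>) (ham_lie sK sA br \<rho> \<omega>) X"
  by (simp add: lie_hom_def poisson_lie_def ham_lie_def LRJ_lie_def sgrad_add sgrad_scale
      sgrad_poisson)

lemma poisson_central_extension:
  "lie_central_extension (H0_lie sK br \<rho> \<omega>) id
     (poisson_lie sK br \<rho> \<omega>) X (ham_lie sK sA br \<rho> \<omega>)"
proof -
  have central: "P c a = 0" if "c \<in> H0 \<rho>" for c a
    using that by (simp add: poisson_eq_anchor sgrad_eq_0_iff[THEN iffD2])
  have "K.subspace (H0 \<rho>)"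
    by (auto simp: K.subspace_def H0_def anchor_add anchor_scale)
  then have "lie_algebra (H0_lie sK br \<rho> \<omega>)"
    using central unfolding H0_lie_def
    by (intro lie_algebra_subalgebra[OF lie_algebra_poisson])
       (auto simp: poisson_lie_def H0_def)
  moreover have "lie_algebra (ham_lie sK sA br \<rho> \<omega>)"
    using lie_algebraD(1)[OF lie_G]
    by (intro lie_algebra_image[OF lie_algebra_poisson _ lie_hom_sgrad])
       (simp_all add: ham_lie_def poisson_lie_def)
  ultimately show ?thesis
    using lie_algebra_poisson lie_hom_sgrad central
    by (auto simp: lie_central_extension_def lie_hom_def H0_lie_def poisson_lie_def ham_lie_def
        sgrad_eq_0_iff)
qed

section \<open>Strict symmetries of the canonical form\<close>

text \<open>
  On a single argument \<open>y + ge\<close>, the form \<open>i\<^sub>u d\<eta>\<close> takes the value \<open>- \<omega>(x, y)\<close>, since the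
  \<open>\<rho>\<close>-terms of the extended bracket cancel those of the differential, and \<open>d i\<^sub>u \<eta>\<close> takes the
  value \<open>\<rho>(y)(f)\<close>. Every other number of arguments contributes 0.
\<close>

lemma lie_deriv_eta:
  "lie_deriv (ext_bracket br \<rho> \<omega>) (ext_anchor \<rho>) (x, f) ext_eta = (\<lambda>_. 0)
     \<longleftrightarrow> (\<forall>y. \<omega> [x, y] = \<rho> y f)"
proof -
  let ?L = "lie_deriv (ext_bracket br \<rho> \<omega>) (ext_anchor \<rho>) (x, f) ext_eta"
  have eta: "ext_eta us = (0::'a)" if "length us \<noteq> 1" for us :: "('g \<times> 'a) list"
    using that by (auto simp: ext_eta_def split: list.split)
  have one: "?L [(y, g)] = \<rho> y f - \<omega> [x, y]" for y g
    by (simp add: lie_deriv_def iprod_def cdiff_1 cdiff_2 ext_eta_def ext_anchor_def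
        ext_bracket_def)
  have other: "?L us = 0" if "length us \<noteq> 1" for us
  proof (cases us)
    case Nil
    then show ?thesis
      by (simp add: lie_deriv_def iprod_def cdiff_0 cdiff_1 ext_anchor_def eta)
  next
    case (Cons u vs)
    with that have len: "length us \<ge> 2" by (cases vs) auto
    have "cdiff (ext_bracket br \<rho> \<omega>) (ext_anchor \<rho>) ext_eta ((x, f) # us) = 0"
      using len by (intro cdiff_zero_beyond) (auto simp: ext_anchor_def intro!: eta)
    moreover have "cdiff (ext_bracket br \<rho> \<omega>) (ext_anchor \<rho>) (iprod (x, f) ext_eta) us = 0"
      using len by (intro cdiff_zero_beyond) (auto simp: ext_anchor_def iprod_def intro!: eta)
    ultimately show ?thesis by (simp add: lie_deriv_def iprod_def)
  qed
  show ?thesis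
  proof
    assume L: "?L = (\<lambda>_. 0)"
    then show "\<forall>y. \<omega> [x, y] = \<rho> y f"
      using one[of _ 0] by simp
  next
    assume *: "\<forall>y. \<omega> [x, y] = \<rho> y f"
    show "?L = (\<lambda>_. 0)"
    proof
      fix us show "?L us = 0"
      proof (cases "length us = 1")
        case True
        then obtain y g where "us = [(y, g)]" by (auto simp: length_Suc_conv)
        then show ?thesis using one * by simp
      qed (rule other)
    qed
  qed
qed

lemma cont_str_eq: "cont_str br \<rho> \<omega> = range (\<lambda>a. (X a, a))"
  by (auto simp: cont_str_def lie_deriv_eta omega_sgrad image_iff sgrad_eq_iff[symmetric])

lemma vector_space_ext: "vector_space (restrict_scale sK (ext_scale sA))"
proof -
  have "vector_space (restrict_scale sK sA)"
    using lie_algebraD(1)[OF lie_G] by (simp add: LRJ_lie_def)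
  then show ?thesis
    using K.vector_space_axioms
    unfolding vector_space_def restrict_scale_def ext_scale_def
    by (simp add: sK_eq_mult[symmetric] distrib_right)
qed

text \<open>
  The component along \<open>e\<close> is \<open>\<rho>(X\<^sub>a)(b) - \<rho>(X\<^sub>b)(a) + \<omega>(X\<^sub>a, X\<^sub>b)\<close>, that is
  \<open>{a, b} + {a, b} - {a, b}\<close>.
\<close>

lemma ext_bracket_graph: "ext_bracket br \<rho> \<omega> (X a, a) (X b, b) = (X (P a b), P a b)"
proof -
  have "\<omega> [X a, X b] = - P a b" by (simp add: poisson_def)
  then show ?thesis
    using poisson_antisym[of b a]
    by (simp add: ext_bracket_def sgrad_poisson poisson_eq_anchor[symmetric])
qed

lemma lie_iso_graph:
  "lie_iso (poisson_lie sK br \<rho> \<omega>) (cont_str_lie sK sA br \<rho> \<omega>) (\<lambda>a. (X a, a))"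
  by (auto simp: lie_iso_def lie_hom_def bij_betw_def inj_on_def poisson_lie_def
      cont_str_lie_def ext_lie_def LRJ_lie_def cont_str_eq ext_bracket_graph sgrad_add
      sgrad_scale restrict_scale_def ext_scale_def sK_eq_mult[symmetric])

lemma graph_H0: "c \<in> H0 \<rho> \<Longrightarrow> (X c, c) = ext_scale sA c ext_e"
  by (simp add: ext_scale_def ext_e_def sgrad_eq_0_iff)

lemma lie_iso_graph_H0:
  "lie_iso (H0_lie sK br \<rho> \<omega>) (H0e_lie sK sA br \<rho> \<omega>) (\<lambda>a. (X a, a))"
proof -
  have "lcarrier (H0e_lie sK sA br \<rho> \<omega>) = (\<lambda>a. (X a, a)) ` lcarrier (H0_lie sK br \<rho> \<omega>)"
    by (auto simp: H0e_lie_def H0_lie_def graph_H0 image_iff)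
  then show ?thesis
    using lie_iso_graph
    by (auto simp: lie_iso_def lie_hom_def bij_betw_def inj_on_def poisson_lie_def H0_lie_def
      H0e_lie_def cont_str_lie_def ext_lie_def LRJ_lie_def)
qed

lemma contact_central_extension:
  "lie_central_extension (H0e_lie sK sA br \<rho> \<omega>) id
     (cont_str_lie sK sA br \<rho> \<omega>) fst (ham_lie sK sA br \<rho> \<omega>)"
  by (rule lie_central_extension_transport[OF poisson_central_extension lie_iso_graph_H0
        lie_iso_graph])
     (simp_all add: H0e_lie_def cont_str_lie_def ext_lie_def LRJ_lie_def vector_space_ext)

end

theorem corollary6p5:
  fixes sK :: "'k::field_char_0 \<Rightarrow> 'a::comm_ring_1 \<Rightarrow> 'a"
    and sA :: "'a \<Rightarrow> 'g::ab_group_add \<Rightarrow> 'g"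
    and br :: "'g \<Rightarrow> 'g \<Rightarrow> 'g"
    and \<rho> :: "'g \<Rightarrow> 'a \<Rightarrow> 'a"
    and \<omega> :: "'g list \<Rightarrow> 'a"
  assumes "symplectic_LRJ sK sA br \<rho> \<omega>"
  shows "lie_central_extension (H0e_lie sK sA br \<rho> \<omega>) id
           (cont_str_lie sK sA br \<rho> \<omega>) fst (ham_lie sK sA br \<rho> \<omega>) \<and>
         lie_central_extension (H0_lie sK br \<rho> \<omega>) id
           (poisson_lie sK br \<rho> \<omega>) (sgrad br \<rho> \<omega>) (ham_lie sK sA br \<rho> \<omega>) \<and>
         (\<exists>\<Phi>. lie_iso (poisson_lie sK br \<rho> \<omega>) (cont_str_lie sK sA br \<rho> \<omega>) \<Phi> \<and>
           (\<forall>c\<in>H0 \<rho>. \<Phi> c = ext_scale sA c ext_e) \<and>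
           (\<forall>a. fst (\<Phi> a) = sgrad br \<rho> \<omega> a))"
proof -
  interpret symplectic_lrj sK sA br \<rho> \<omega> by unfold_locales (rule assms)
  show ?thesis
    using contact_central_extension poisson_central_extension lie_iso_graph graph_H0
    by (intro conjI exI[of _ "\<lambda>a. (sgrad br \<rho> \<omega> a, a)"]) auto
qed

end
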